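(* Let $\gamma\in(0,+\infty)$. Let $h:\mathbb{R}\to[0,\infty)$ be strictly convex with global minimum at $0$, and let $W:\mathbb{R}\to\mathbb{R}$ be a $1$-periodic even Lipschitz function with $\|W'\|_\infty=1$ and zero average. Let $E_\varepsilon(x)=h(x)+\varepsilon W(x/\varepsilon)$, let $\tau_\varepsilon>0$, $\tau_\varepsilon\to0$, with $\varepsilon/\tau_\varepsilon\to\gamma$ as $\varepsilon\to0$, let $x_0^\varepsilon\to x_0$, and let $x:[0,+\infty)\to\mathbb{R}$ be a minimising movement for $E_\varepsilon$ at time scale $\tau_\varepsilon$ from $x_0^\varepsilon$. Let $t_0$ be such that the derivative $x'(t_0)$ exists. Then $$\gamma\, f_\gamma\big(h'(x(t_0)^-)\big)\le -x'(t_0)\le \gamma\, f_\gamma\big(h'(x(t_0)^+)\big).$$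
   Context: Minimising movement: for fixed $\varepsilon>0$ define recursively, for $i\ge1$, $x_i^\varepsilon$ as a minimiser over $x\in\mathbb{R}$ of $E_\varepsilon(x)+\frac{1}{2\tau_\varepsilon}(x-x_{i-1}^\varepsilon)^2$, and set $x^\varepsilon(t)=x^\varepsilon_{\lfloor t/\tau_\varepsilon\rfloor}$ for $t\ge0$. A minimising movement for $E_\varepsilon$ at time scale $\tau_\varepsilon$ from $x_0^\varepsilon$ is the limit $x(t)=\lim_{j}x^{\varepsilon_j}(t)$ of a subsequence with $\varepsilon_j\to0$, with convergence uniform on compact subsets of $[0,+\infty)$. Definition of $f_\gamma$: for $T\in\mathbb{R}$ and any $y_0\in\mathbb{R}$ let $y_0^T=y_0$ and, for $i\ge1$, let $y_i^T$ be a minimiser over $y\in\mathbb{R}$ of $Ty+W(y)+\frac{\gamma}{2}(y-y_{i-1}^T)^2$. Then $f_\gamma(T)=\lim_{i\to\infty}(y_0-y_i^T)/i$; this limit exists, does not depend on $y_0$, and $f_\gamma$ is nondecreasing. If minimisers are not unique they are chosen by a fixed selection $y_i^T=a_T(y_{i-1}^T)$ with $a_T(w+1)=a_T(w)+1$ for all $w\in\mathbb{R}$. One-sided values: since $h$ is convex it is differentiable outside a countable set and $h'$ is increasing there; $f_\gamma(h'(z^\pm))$ denotes $\lim f_\gamma(h'(z\pm\delta))$ as $\delta\to0^+$ through values $\delta>0$ for which $h'(z\pm\delta)$ exists. *)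

theory Defs
  imports "HOL-Analysis.Analysis" "HOL-Probability.Essential_Supremum"
begin

abbreviation minimiser :: "(real \<Rightarrow> real) \<Rightarrow> real \<Rightarrow> bool"
  where "minimiser F x \<equiv> is_arg_min F (\<lambda>_. True) x"

definition strictly_convex :: "(real \<Rightarrow> real) \<Rightarrow> bool"
  where "strictly_convex h \<longleftrightarrow>
    (\<forall>x y t. x \<noteq> y \<longrightarrow> 0 < t \<longrightarrow> t < 1 \<longrightarrow>
      h ((1 - t) * x + t * y) < (1 - t) * h x + t * h y)"

definition energy :: "(real \<Rightarrow> real) \<Rightarrow> (real \<Rightarrow> real) \<Rightarrow> real \<Rightarrow> real \<Rightarrow> real"
  where "energy h W \<epsilon> x = h x + \<epsilon> * W (x / \<epsilon>)"

definition discrete_solution ::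
    "(real \<Rightarrow> real) \<Rightarrow> real \<Rightarrow> real \<Rightarrow> (nat \<Rightarrow> real) \<Rightarrow> bool"
  where "discrete_solution F \<tau> x\<^sub>0 X \<longleftrightarrow>
    X 0 = x\<^sub>0 \<and>
    (\<forall>i. minimiser (\<lambda>x. F x + 1 / (2 * \<tau>) * (x - X i)\<^sup>2) (X (Suc i)))"

definition minimising_movement ::
    "(real \<Rightarrow> real \<Rightarrow> real) \<Rightarrow> (real \<Rightarrow> real) \<Rightarrow> (real \<Rightarrow> real) \<Rightarrow> (real \<Rightarrow> real) \<Rightarrow> bool"
  where "minimising_movement E \<tau> x\<^sub>0 x \<longleftrightarrow>
    (\<exists>X e. (\<forall>\<epsilon>>0. discrete_solution (E \<epsilon>) (\<tau> \<epsilon>) (x\<^sub>0 \<epsilon>) (X \<epsilon>)) \<and>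
      (\<forall>j::nat. 0 < e j) \<and> e \<longlonglongrightarrow> 0 \<and>
      (\<forall>K. compact K \<longrightarrow> K \<subseteq> {0..} \<longrightarrow>
        uniform_limit K (\<lambda>j t. X (e j) (nat \<lfloor>t / \<tau> (e j)\<rfloor>)) x sequentially))"

definition minimiser_selection ::
    "real \<Rightarrow> (real \<Rightarrow> real) \<Rightarrow> (real \<Rightarrow> real \<Rightarrow> real) \<Rightarrow> bool"
  where "minimiser_selection \<gamma> W a \<longleftrightarrow>
    (\<forall>T w. minimiser (\<lambda>y. T * y + W y + \<gamma> / 2 * (y - w)\<^sup>2) (a T w)) \<and>
    (\<forall>T w. a T (w + 1) = a T w + 1)"

text \<open>The function \<open>f\<^sub>\<gamma>\<close>, computed with the selection \<open>a\<close> (the parameter \<open>\<gamma>\<close> and the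
  potential enter only through \<open>a\<close>): the limit common to all starting points \<open>y\<^sub>0\<close>.\<close>
definition f_gamma :: "(real \<Rightarrow> real \<Rightarrow> real) \<Rightarrow> real \<Rightarrow> real"
  where "f_gamma a T =
    (THE L. \<forall>y\<^sub>0. (\<lambda>i. (y\<^sub>0 - (a T ^^ i) y\<^sub>0) / real i) \<longlonglongrightarrow> L)"

text \<open>The one-sided values \<open>f(h'(z\<^sup>+))\<close> and \<open>f(h'(z\<^sup>-))\<close>: the limits of \<open>f(h'(z \<plusminus> \<delta>))\<close> as
  \<open>\<delta>\<close> decreases to 0 through those values for which the derivative exists.\<close>
definition right_value :: "(real \<Rightarrow> real) \<Rightarrow> (real \<Rightarrow> real) \<Rightarrow> real \<Rightarrow> real"
  where "right_value f h z =
    Lim (at 0 within {\<delta>. 0 < \<delta> \<and> h field_differentiable at (z + \<delta>)})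
      (\<lambda>\<delta>. f (deriv h (z + \<delta>)))"

definition left_value :: "(real \<Rightarrow> real) \<Rightarrow> (real \<Rightarrow> real) \<Rightarrow> real \<Rightarrow> real"
  where "left_value f h z =
    Lim (at 0 within {\<delta>. 0 < \<delta> \<and> h field_differentiable at (z - \<delta>)})
      (\<lambda>\<delta>. f (deriv h (z - \<delta>)))"

end

theory Submission
  imports Defs
begin

text \<open>
  In the variable \<open>y = x / \<epsilon>\<close> one step of the scheme minimises
  \<open>h (\<epsilon> y) / \<epsilon> + W y + (\<epsilon> / \<tau>) / 2 * (y - w)\<^sup>2\<close>. On a short time interval the solution
  stays near a point \<open>z = x t\<^sub>0\<close>, where the slopes of
  the first term are almost between the one-sided derivatives of \<open>h\<close> at \<open>z\<close>, and \<open>\<epsilon> / \<tau>\<close> is almost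
  \<open>\<gamma>\<close>. This suggests comparing the scheme with the homogeneous one, which minimises
  \<open>T y + W y + \<gamma> / 2 * (y - w)\<^sup>2\<close> and whose mean velocity is \<open>- f\<^sub>\<gamma> T\<close>.

  The comparison rests on the one-dimensional ordering of minimisers: a larger slope and a smaller
  previous position give a smaller minimiser, whatever \<open>W\<close> is, since the two occurrences
  of \<open>W\<close> cancel when the two minimality inequalities are added. If \<open>T\<close> exceeds every
  slope of \<open>h\<close> to the left of \<open>z + r\<close> by a fixed amount, this gap also absorbs the
  error \<open>\<gamma> - \<epsilon> / \<tau>\<close>, because steps have bounded length in the variable \<open>y\<close>;
  this is \<open>step_comparison\<close>. Hence, as long as the solution stays to the left of
  \<open>z + r / 2\<close>, it is bounded below by the homogeneous orbit.

  The homogeneous step map is monotone and commutes with the unit translation, so it is a lift of a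
  circle map and \<open>f\<^sub>\<gamma> T\<close> is, up to sign, its rotation number. The decisive
  feature is that after \<open>n\<close> steps the displacement differs from \<open>- n f\<^sub>\<gamma> T\<close>
  by a bounded amount, uniformly in the starting point (\<open>f_gamma_displacement\<close>). Over a time
  \<open>s\<close> there are about \<open>s / \<tau>\<close> steps; multiplying by \<open>\<epsilon>\<close>, the
  bounded error disappears and the increment of \<open>x\<close> is at least \<open>- \<gamma> s f\<^sub>\<gamma> T\<close>
  (\<open>increment_lower_bound\<close>). Dividing by \<open>s\<close> gives \<open>- v \<le> \<gamma> f\<^sub>\<gamma> T\<close>,
  and the reflection \<open>x \<mapsto> - x\<close> gives the opposite inequality for slopes \<open>T\<close>
  below those of \<open>h\<close> near \<open>z\<close>.

  By strict convexity \<open>T\<close> may be any subgradient of \<open>h\<close> at \<open>z + \<delta>\<close>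
  or \<open>z - \<delta>\<close>. Subgradients agree with \<open>h'\<close> off a countable set and
  \<open>f\<^sub>\<gamma>\<close> is nondecreasing, so the one-sided limits exist and inherit the bounds.
\<close>

section \<open>Rotation numbers of monotone maps of degree one\<close>

lemma funpow_shift_int:
  fixes A :: "real \<Rightarrow> real"
  assumes shift: "\<And>w. A (w + 1) = A w + 1"
  shows "(A ^^ n) (w + of_int k) = (A ^^ n) w + of_int k"
proof -
  have one: "A (w + of_int k) = A w + of_int k" for w k
  proof (induction k rule: int_induct[where k = 0])
    case base
    then show ?case by simp
  next
    case (step1 i)
    then show ?case using shift[of "w + of_int i"] by (simp add: add.assoc)
  next
    case (step2 i)
    then show ?case using shift[of "w + of_int i - 1"] by (simp add: algebra_simps)
  qed
  show ?thesis by (induction n) (simp_all add: one)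
qed

text \<open>A translation by an integer does not change the displacement of a point, and two points in the same
  unit interval are kept in order and at distance at most one by the iterates.\<close>

lemma displacement_oscillation:
  fixes A :: "real \<Rightarrow> real"
  assumes mono: "mono A" and shift: "\<And>w. A (w + 1) = A w + 1"
  shows "\<bar>((A ^^ n) u - u) - ((A ^^ n) w - w)\<bar> \<le> 1"
proof -
  define k where "k = \<lfloor>u - w\<rfloor>"
  have k: "w + of_int k \<le> u" "u \<le> w + of_int (k + 1)"
    unfolding k_def by linarith+
  have "mono (A ^^ n)" using mono by (rule mono_pow)
  then have "(A ^^ n) (w + of_int k) \<le> (A ^^ n) u"
    "(A ^^ n) u \<le> (A ^^ n) (w + of_int (k + 1))"
    using k by (auto dest: monoD)
  then show ?thesis
    using k unfolding funpow_shift_int[of A, OF shift] by (simp add: abs_le_iff)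
qed

text \<open>Each block of \<open>n\<close> iterations displaces its own starting point, and by the previous lemma
  replacing that point by \<open>w\<close> costs at most one per block.\<close>

lemma displacement_multiple:
  fixes A :: "real \<Rightarrow> real"
  assumes mono: "mono A" and shift: "\<And>w. A (w + 1) = A w + 1"
  shows "\<bar>((A ^^ (m * n)) w - w) - real m * ((A ^^ n) w - w)\<bar> \<le> real m"
proof (induction m)
  case 0
  then show ?case by simp
next
  case (Suc m)
  have "(A ^^ (Suc m * n)) w = (A ^^ n) ((A ^^ (m * n)) w)"
    by (simp add: funpow_add)
  then show ?case
    using Suc displacement_oscillation[of A n "(A ^^ (m * n)) w" w, OF mono shift]
    by (simp add: algebra_simps)
qed

text \<open>Comparing \<open>m n\<close> iterations with \<open>m\<close> blocks of \<open>n\<close> and with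
  \<open>n\<close> blocks of \<open>m\<close> shows that the mean displacements form a Cauchy sequence, with
  an error \<open>1 / n + 1 / m\<close>. It is the rate \<open>1 / n\<close> that makes the total deviation
  bounded. The sign convention, displacement to the left, is that of \<open>f_gamma\<close>.\<close>

lemma rotation_number_exists:
  fixes A :: "real \<Rightarrow> real"
  assumes mono: "mono A" and shift: "\<And>w. A (w + 1) = A w + 1"
  shows "\<exists>\<rho>. \<forall>n y. \<bar>y - (A ^^ n) y - real n * \<rho>\<bar> \<le> 2"
proof -
  define c where "c n = 0 - (A ^^ n) 0" for n
  \<comment> \<open>Both sides are compared with the displacement after \<open>m n\<close> iterations.\<close>
  have cross: "\<bar>real m * c n - real n * c m\<bar> \<le> real m + real n" for m n
    using displacement_multiple[of A m n 0, OF mono shift]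
      displacement_multiple[of A n m 0, OF mono shift]
    unfolding c_def by (simp add: mult.commute)
  have close: "\<bar>c n / real n - c m / real m\<bar> \<le> 1 / real n + 1 / real m"
    if "0 < n" "0 < m" for m n
  proof -
    have "c n / real n - c m / real m = (real m * c n - real n * c m) / (real n * real m)"
      using that by (simp add: field_simps)
    then have "\<bar>c n / real n - c m / real m\<bar> \<le> (real m + real n) / (real n * real m)"
      using cross[of m n] that by (simp add: abs_mult divide_right_mono)
    also have "\<dots> = 1 / real n + 1 / real m" using that by (simp add: field_simps)
    finally show ?thesis .
  qed
  have "Cauchy (\<lambda>n. c n / real n)"
  proof (rule metric_CauchyI)
    fix e :: real assume "0 < e"
    then obtain M where M: "0 < M" "1 / real M < e / 2"
      using real_arch_inverse[of "e / 2"] by (auto simp: inverse_eq_divide)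
    show "\<exists>M. \<forall>m\<ge>M. \<forall>n\<ge>M. dist (c m / real m) (c n / real n) < e"
    proof (intro exI allI impI)
      fix m n assume mn: "M \<le> m" "M \<le> n"
      then have "1 / real m \<le> 1 / real M" "1 / real n \<le> 1 / real M"
        using M by (simp_all add: frac_le)
      then show "dist (c m / real m) (c n / real n) < e"
        using close[of m n] mn M unfolding dist_real_def by linarith
    qed
  qed
  then obtain \<rho> where \<rho>: "(\<lambda>n. c n / real n) \<longlonglongrightarrow> \<rho>"
    using Cauchy_convergent convergent_def by blast
  \<comment> \<open>Let \<open>m\<close> tend to infinity in \<open>close\<close> and multiply by \<open>n\<close>.\<close>
  have limit: "\<bar>c n - real n * \<rho>\<bar> \<le> 1" if n: "0 < n" for n
  proof -
    have "\<bar>c n / real n - \<rho>\<bar> \<le> 1 / real n + 0"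
    proof (rule tendsto_le[OF trivial_limit_sequentially])
      show "(\<lambda>m. \<bar>c n / real n - c m / real m\<bar>) \<longlonglongrightarrow> \<bar>c n / real n - \<rho>\<bar>"
        by (intro tendsto_intros \<rho>)
      show "(\<lambda>m. 1 / real n + 1 / real m) \<longlonglongrightarrow> 1 / real n + 0"
        by (intro tendsto_intros lim_1_over_n)
      show "\<forall>\<^sub>F m in sequentially. \<bar>c n / real n - c m / real m\<bar> \<le> 1 / real n + 1 / real m"
        using eventually_gt_at_top[of 0] by eventually_elim (rule close[OF n])
    qed
    then have "real n * \<bar>c n / real n - \<rho>\<bar> \<le> real n * (1 / real n)"
      by (intro mult_left_mono) auto
    moreover have "c n - real n * \<rho> = real n * (c n / real n - \<rho>)"
      using n by (simp add: field_simps)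
    ultimately show ?thesis using n by (simp add: abs_mult)
  qed
  have "\<bar>y - (A ^^ n) y - real n * \<rho>\<bar> \<le> 2" for n y
  proof (cases "n = 0")
    case False
    then show ?thesis
      using limit[of n] displacement_oscillation[of A n y 0, OF mono shift]
      unfolding c_def by simp
  qed simp
  then show ?thesis by blast
qed

section \<open>Comparison of minimisers\<close>

lemma minimiserD: "minimiser F x \<Longrightarrow> F x \<le> F y"
  by (simp add: is_arg_min_linorder)

text \<open>Adding the two minimality inequalities, each tested with the other minimiser, cancels \<open>W\<close> and
  the squares of the minimisers, and leaves a product with the factor \<open>y2 - y1\<close>. Strictness in
  one of the two parameters is essential, since minimisers need not be unique.\<close>

lemma minimiser_antimono:
  fixes W :: "real \<Rightarrow> real"
  assumes "0 < \<gamma>" "T1 \<le> T2" "w2 \<le> w1" "T1 < T2 \<or> w2 < w1"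
    and min1: "minimiser (\<lambda>y. T1 * y + W y + \<gamma> / 2 * (y - w1)\<^sup>2) y1"
    and min2: "minimiser (\<lambda>y. T2 * y + W y + \<gamma> / 2 * (y - w2)\<^sup>2) y2"
  shows "y2 \<le> y1"
proof (rule ccontr)
  assume "\<not> y2 \<le> y1"
  then have less: "0 < y2 - y1" by simp
  have "(T2 - T1 + \<gamma> * (w1 - w2)) * (y2 - y1) \<le> 0"
    using minimiserD[OF min1, of y2] minimiserD[OF min2, of y1]
    by (simp add: power2_eq_square algebra_simps)
  moreover have "0 < T2 - T1 + \<gamma> * (w1 - w2)"
    using assms(1-4) by (auto intro: add_pos_nonneg add_nonneg_pos)
  ultimately show False using less by (simp add: mult_le_0_iff)
qed

text \<open>Testing minimality with \<open>w\<close> itself: the quadratic penalty of a step is paid by the energy,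
  which is Lipschitz. The bound does not depend on the position \<open>w\<close>.\<close>

lemma minimiser_advance_bound:
  fixes W :: "real \<Rightarrow> real"
  assumes pos: "0 < \<gamma>" and lip: "L-lipschitz_on UNIV W"
    and min: "minimiser (\<lambda>y. T * y + W y + \<gamma> / 2 * (y - w)\<^sup>2) y"
  shows "y - w \<le> 2 * (\<bar>T\<bar> + L) / \<gamma>"
proof (cases "w < y")
  case True
  have "\<bar>W w - W y\<bar> \<le> L * \<bar>w - y\<bar>"
    using lipschitz_onD[OF lip, of w y] by (simp add: dist_real_def)
  moreover have "- (T * (y - w)) \<le> \<bar>T\<bar> * (y - w)"
    using True mult_right_mono[of "- T" "\<bar>T\<bar>" "y - w"] by simp
  ultimately have "\<gamma> / 2 * (y - w)\<^sup>2 \<le> (\<bar>T\<bar> + L) * (y - w)"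
    using minimiserD[OF min, of w] True by (simp add: algebra_simps)
  then have "(\<gamma> / 2 * (y - w)) * (y - w) \<le> (\<bar>T\<bar> + L) * (y - w)"
    by (simp add: power2_eq_square mult.assoc)
  then have "\<gamma> / 2 * (y - w) \<le> \<bar>T\<bar> + L"
    using True by (auto dest: mult_right_le_imp_le)
  then show ?thesis using pos by (simp add: field_simps)
next
  case False
  have "0 \<le> L" using lip by (rule lipschitz_on_nonneg)
  then have "0 \<le> 2 * (\<bar>T\<bar> + L) / \<gamma>" using pos by simp
  then show ?thesis using False by linarith
qed

text \<open>The order is preserved by one step of two schemes with different energies and different penalty
  coefficients \<open>\<gamma>\<close> and \<open>g\<close>. If the new positions were in the wrong order, both would
  be within \<open>C\<close> of \<open>w2\<close>; there, the derivatives of the two penalties differ by at most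
  \<open>\<bar>\<gamma> - g\<bar> * C\<close> besides the shift from \<open>w1\<close> to \<open>w2\<close>, and this is
  less than the gap between the slopes. The slope hypothesis is one-sided so that it can be applied to
  a convex function, whose slopes to the left of a point are bounded above, without localisation from
  below.\<close>

lemma step_comparison:
  fixes W k :: "real \<Rightarrow> real"
  assumes pos: "0 < \<gamma>" and g: "\<gamma> / 2 \<le> g" and lip: "L-lipschitz_on UNIV W"
    and C: "2 * (\<bar>T\<bar> + L) / \<gamma> \<le> C" "4 * (\<bar>S\<bar> + L) / \<gamma> \<le> C"
    and slope: "\<And>u v. u < v \<Longrightarrow> v \<le> w2 + C \<Longrightarrow> k v - k u \<le> S * (v - u)"
    and gap: "S + \<bar>\<gamma> - g\<bar> * C < T"
    and min1: "minimiser (\<lambda>y. T * y + W y + \<gamma> / 2 * (y - w1)\<^sup>2) y1"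
    and min2: "minimiser (\<lambda>y. k y + W y + g / 2 * (y - w2)\<^sup>2) y2"
    and le: "w1 \<le> w2"
  shows "y1 \<le> y2"
proof (rule ccontr)
  assume "\<not> y1 \<le> y2"
  then have less: "0 < y1 - y2" by simp
  have "0 \<le> L" using lip by (rule lipschitz_on_nonneg)
  then have "0 \<le> 2 * (\<bar>T\<bar> + L) / \<gamma>" using pos by simp
  then have C0: "0 \<le> C" using C(1) by linarith
  \<comment> \<open>In the wrong order, the two new positions lie between \<open>w2 - C\<close> and \<open>w2 + C\<close>.\<close>
  have up: "y1 - w1 \<le> C"
    using minimiser_advance_bound[OF pos lip min1] C(1) by linarith
  have low: "w2 - y2 \<le> C"
  proof (cases "y2 < w2")
    case True
    have "\<bar>W w2 - W y2\<bar> \<le> L * \<bar>w2 - y2\<bar>"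
      using lipschitz_onD[OF lip, of w2 y2] by (simp add: dist_real_def)
    moreover have "k w2 - k y2 \<le> \<bar>S\<bar> * (w2 - y2)"
      using slope[of y2 w2] True C0 mult_right_mono[of S "\<bar>S\<bar>" "w2 - y2"] by linarith
    ultimately have "g / 2 * (w2 - y2)\<^sup>2 \<le> (\<bar>S\<bar> + L) * (w2 - y2)"
      using minimiserD[OF min2, of w2] True
      unfolding power2_commute[of w2 y2] by (simp add: algebra_simps)
    then have "(g / 2 * (w2 - y2)) * (w2 - y2) \<le> (\<bar>S\<bar> + L) * (w2 - y2)"
      by (simp add: power2_eq_square mult.assoc)
    then have "g / 2 * (w2 - y2) \<le> \<bar>S\<bar> + L"
      using True by (auto dest: mult_right_le_imp_le)
    \<comment> \<open>Half of \<open>\<gamma>\<close> is lost in \<open>g\<close>, whence the constant 4 instead of 2.\<close>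
    moreover have "\<gamma> / 4 * (w2 - y2) \<le> g / 2 * (w2 - y2)"
      using g True by (intro mult_right_mono) auto
    ultimately have "w2 - y2 \<le> 4 * (\<bar>S\<bar> + L) / \<gamma>"
      using pos by (simp add: field_simps)
    then show ?thesis using C(2) by linarith
  qed (use C0 in auto)
  have sl: "k y1 - k y2 \<le> S * (y1 - y2)"
    using slope[of y2 y1] less up le by simp
  have mid: "\<bar>(y1 + y2) / 2 - w2\<bar> \<le> C" using up low less le by (simp add: abs_le_iff field_simps)
  \<comment> \<open>The sum of the two minimality inequalities, with the factor \<open>y1 - y2\<close> taken out.\<close>
  have "(T + \<gamma> * (w2 - w1) + (\<gamma> - g) * ((y1 + y2) / 2 - w2)) * (y1 - y2) \<le> k y1 - k y2"
  proof -
    have "T * (y1 - y2) + \<gamma> / 2 * ((y1 - w1)\<^sup>2 - (y2 - w1)\<^sup>2)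
        + g / 2 * ((y2 - w2)\<^sup>2 - (y1 - w2)\<^sup>2) \<le> k y1 - k y2"
      using minimiserD[OF min1, of y2] minimiserD[OF min2, of y1]
      by (simp add: right_diff_distrib)
    moreover have "(y1 - w1)\<^sup>2 - (y2 - w1)\<^sup>2 = 2 * ((y1 + y2) / 2 - w1) * (y1 - y2)"
      "(y2 - w2)\<^sup>2 - (y1 - w2)\<^sup>2 = - 2 * ((y1 + y2) / 2 - w2) * (y1 - y2)"
      by (simp_all add: power2_eq_square field_simps)
    moreover have "(T + \<gamma> * (w2 - w1) + (\<gamma> - g) * (c - w2)) * d
        = T * d + \<gamma> / 2 * (2 * (c - w1) * d) + g / 2 * (- 2 * (c - w2) * d)" for c d
      by (simp add: algebra_simps)
    ultimately show ?thesis by simp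
  qed
  also have "\<dots> \<le> S * (y1 - y2)" by (rule sl)
  finally have "T + \<gamma> * (w2 - w1) + (\<gamma> - g) * ((y1 + y2) / 2 - w2) \<le> S"
    using less by (auto dest: mult_right_le_imp_le)
  moreover have "0 \<le> \<gamma> * (w2 - w1)" using pos le by simp
  moreover have "- (\<bar>\<gamma> - g\<bar> * C) \<le> (\<gamma> - g) * ((y1 + y2) / 2 - w2)"
  proof -
    have "\<bar>(\<gamma> - g) * ((y1 + y2) / 2 - w2)\<bar> \<le> \<bar>\<gamma> - g\<bar> * C"
      unfolding abs_mult using mid by (intro mult_left_mono) auto
    then show ?thesis by linarith
  qed
  ultimately show False using gap by linarith
qed

section \<open>The effective velocity as a rotation number\<close>

lemma selection_mono:
  assumes "0 < \<gamma>" "minimiser_selection \<gamma> W a"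
  shows "mono (a T)"
proof (rule monoI)
  fix w2 w1 :: real assume "w2 \<le> w1"
  then show "a T w2 \<le> a T w1"
    using assms minimiser_antimono[of \<gamma> T T w2 w1 W "a T w1" "a T w2"]
    unfolding minimiser_selection_def by (cases "w2 = w1") auto
qed

text \<open>The definite description in \<open>f_gamma\<close> denotes the rotation number of the leftward
  displacement: bounded deviation yields
  the limit for every starting point. The bound itself, rather than the limit, is what the
  comparison uses, since the homogeneous orbit is started at a point that varies with the scale.\<close>

lemma f_gamma_displacement:
  assumes "0 < \<gamma>" and sel: "minimiser_selection \<gamma> W a"
  shows "\<bar>y - (a T ^^ n) y - real n * f_gamma a T\<bar> \<le> 2"
proof -
  have shift: "a T (w + 1) = a T w + 1" for w
    using sel unfolding minimiser_selection_def by blast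
  obtain \<rho> where \<rho>: "\<And>n y. \<bar>y - (a T ^^ n) y - real n * \<rho>\<bar> \<le> 2"
    using rotation_number_exists[OF selection_mono[OF assms] shift] by blast
  have lim: "(\<lambda>i. (y0 - (a T ^^ i) y0) / real i) \<longlonglongrightarrow> \<rho>" for y0
  proof (rule LIM_zero_cancel, rule Lim_null_comparison)
    show "\<forall>\<^sub>F i in sequentially. norm ((y0 - (a T ^^ i) y0) / real i - \<rho>) \<le> 2 / real i"
      using eventually_gt_at_top[of 0]
    proof eventually_elim
      case (elim i)
      have "(y0 - (a T ^^ i) y0) / real i - \<rho> = (y0 - (a T ^^ i) y0 - real i * \<rho>) / real i"
        using elim by (simp add: field_simps)
      then show ?case using \<rho>[of y0 i] elim by (simp add: divide_right_mono)
    qed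
    show "(\<lambda>i. 2 / real i) \<longlonglongrightarrow> 0" by (rule lim_const_over_n)
  qed
  have "f_gamma a T = \<rho>"
    unfolding f_gamma_def
  proof (rule the_equality)
    show "L = \<rho>" if "\<forall>y0. (\<lambda>i. (y0 - (a T ^^ i) y0) / real i) \<longlonglongrightarrow> L" for L
      using that lim LIMSEQ_unique by blast
  qed (use lim in blast)
  then show ?thesis using \<rho> by simp
qed

text \<open>A larger slope moves every iterate to the left, and since the deviations stay bounded as
  \<open>n\<close> grows, the order of the iterates is inherited by the rotation numbers.\<close>

lemma f_gamma_mono:
  assumes pos: "0 < \<gamma>" and sel: "minimiser_selection \<gamma> W a"
  shows "mono (f_gamma a)"
proof (rule monoI)
  fix T1 T2 :: real assume T: "T1 \<le> T2"
  have min: "minimiser (\<lambda>y. T * y + W y + \<gamma> / 2 * (y - w)\<^sup>2) (a T w)" for T w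
    using sel unfolding minimiser_selection_def by blast
  have iter: "(a T2 ^^ n) 0 \<le> (a T1 ^^ n) 0" for n
  proof (induction n)
    case (Suc n)
    then show ?case
      using minimiser_antimono[OF pos T Suc _ min min] T by (cases "T1 = T2") auto
  qed simp
  have bound: "real n * (f_gamma a T1 - f_gamma a T2) \<le> 4" for n
    using iter[of n] f_gamma_displacement[OF assms, where y = 0 and n = n and T = T1]
      f_gamma_displacement[OF assms, where y = 0 and n = n and T = T2]
    by (simp add: algebra_simps)
  show "f_gamma a T1 \<le> f_gamma a T2"
  proof (rule ccontr)
    assume "\<not> f_gamma a T1 \<le> f_gamma a T2"
    then obtain n where "4 < real n * (f_gamma a T1 - f_gamma a T2)"
      using reals_Archimedean3[of "f_gamma a T1 - f_gamma a T2"] by auto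
    then show False using bound[of n] by linarith
  qed
qed

section \<open>From discrete increments to the limit velocity\<close>

lemma rescaled_minimiser:
  assumes e: "0 < e"
    and min: "minimiser (\<lambda>x. energy h W e x + 1 / (2 * \<tau>) * (x - p)\<^sup>2) q"
  shows "minimiser (\<lambda>y. h (e * y) / e + W y + (e / \<tau>) / 2 * (y - p / e)\<^sup>2) (q / e)"
proof -
  have eq: "energy h W e (e * y) + 1 / (2 * \<tau>) * (e * y - p)\<^sup>2
      = e * (h (e * y) / e + W y + (e / \<tau>) / 2 * (y - p / e)\<^sup>2)" for y
  proof -
    have "e * y - p = e * (y - p / e)" using e by (simp add: field_simps)
    then have "(e * y - p)\<^sup>2 = e * e * (y - p / e)\<^sup>2" by (simp add: power_mult_distrib power2_eq_square)
    then show ?thesis using e unfolding energy_def by (simp add: distrib_left)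
  qed
  have "e * (h (e * (q / e)) / e + W (q / e) + (e / \<tau>) / 2 * (q / e - p / e)\<^sup>2)
      \<le> e * (h (e * y) / e + W y + (e / \<tau>) / 2 * (y - p / e)\<^sup>2)" for y
    using minimiserD[OF min, of "e * y"] eq[of y] eq[of "q / e"] e by simp
  then show ?thesis
    using e unfolding is_arg_min_linorder by simp
qed

text \<open>The orbit of \<open>A\<close> started at the rescaled solution at time \<open>t0\<close> stays below the rescaled
  solution up to time \<open>t0 + s\<close>. Each comparison of steps only meets points to the left of
  \<open>z + r\<close>, where slopes are at most \<open>S\<close>: the limit is below \<open>z + r / 4\<close>, uniform
  convergence costs another \<open>r / 4\<close>, and one step of length \<open>C\<close> in the rescaled
  variable costs at most \<open>r / 2\<close>.\<close>

lemma increment_lower_bound: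
  fixes W h x :: "real \<Rightarrow> real" and X :: "nat \<Rightarrow> nat \<Rightarrow> real" and e \<tau> :: "nat \<Rightarrow> real"
  assumes pos: "0 < \<gamma>" and lip: "L-lipschitz_on UNIV W"
    and e_pos: "\<And>j. 0 < e j" and e_lim: "e \<longlonglongrightarrow> 0"
    and tau_pos: "\<And>j. 0 < \<tau> j" and tau_lim: "\<tau> \<longlonglongrightarrow> 0"
    and ratio: "(\<lambda>j. e j / \<tau> j) \<longlonglongrightarrow> \<gamma>"
    and X: "\<And>j i. minimiser (\<lambda>x. energy h W (e j) x + 1 / (2 * \<tau> j) * (x - X j i)\<^sup>2) (X j (Suc i))"
    and t0: "0 \<le> t0" and s: "0 < s"
    and conv: "uniform_limit {t0..t0 + s} (\<lambda>j t. X j (nat \<lfloor>t / \<tau> j\<rfloor>)) x sequentially"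
    and A: "\<And>w. minimiser (\<lambda>y. T * y + W y + \<gamma> / 2 * (y - w)\<^sup>2) (A w)"
    and \<rho>: "\<And>y n. \<bar>y - (A ^^ n) y - real n * \<rho>\<bar> \<le> 2"
    and ST: "S < T" and r: "0 < r"
    and slope: "\<And>u w. u < w \<Longrightarrow> w \<le> z + r \<Longrightarrow> h w - h u \<le> S * (w - u)"
    and near: "\<And>t. t \<in> {t0..t0 + s} \<Longrightarrow> x t \<le> z + r / 4"
  shows "- (\<gamma> * s * \<rho>) \<le> x (t0 + s) - x t0"
proof -
  define C where "C = 2 * (\<bar>T\<bar> + L) / \<gamma> + 4 * (\<bar>S\<bar> + L) / \<gamma>"
  define m where "m j = nat \<lfloor>t0 / \<tau> j\<rfloor>" for j
  define n where "n j = nat \<lfloor>(t0 + s) / \<tau> j\<rfloor>" for j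
  have L0: "0 \<le> L" using lip by (rule lipschitz_on_nonneg)
  have C: "2 * (\<bar>T\<bar> + L) / \<gamma> \<le> C" "4 * (\<bar>S\<bar> + L) / \<gamma> \<le> C"
    using L0 pos unfolding C_def by simp_all
  have mn: "m j \<le> n j" for j
    unfolding m_def n_def using tau_pos[of j] s by (intro nat_mono floor_mono divide_right_mono) auto
  have "(\<lambda>j. \<bar>\<gamma> - e j / \<tau> j\<bar> * C) \<longlonglongrightarrow> \<bar>\<gamma> - \<gamma>\<bar> * C"
    by (intro tendsto_intros ratio)
  then have ev_gap: "\<forall>\<^sub>F j in sequentially. \<bar>\<gamma> - e j / \<tau> j\<bar> * C < T - S"
    using ST by (intro order_tendstoD) auto
  have "(\<lambda>j. e j * C) \<longlonglongrightarrow> 0 * C" by (intro tendsto_intros e_lim)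
  then have ev_eC: "\<forall>\<^sub>F j in sequentially. e j * C < r / 2"
    using r by (intro order_tendstoD) auto
  have ev_ratio: "\<forall>\<^sub>F j in sequentially. \<gamma> / 2 < e j / \<tau> j"
    using ratio pos by (intro order_tendstoD) auto
  have ev_conv: "\<forall>\<^sub>F j in sequentially. \<forall>t\<in>{t0..t0 + s}. dist (X j (nat \<lfloor>t / \<tau> j\<rfloor>)) (x t) < r / 4"
    using conv r by (intro uniform_limitD) auto
  have ev: "\<forall>\<^sub>F j in sequentially.
      - (e j * (real (n j - m j) * \<rho> + 2)) \<le> X j (n j) - X j (m j)"
    using ev_gap ev_eC ev_ratio ev_conv
  proof eventually_elim
    case (elim j)
    \<comment> \<open>Every index between \<open>m j\<close> and \<open>n j\<close> is attained at a time of the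
      interval: \<open>m j\<close> at \<open>t0\<close>, since \<open>m j * \<tau> j\<close> may precede \<open>t0\<close>,
      and a later \<open>i\<close> at \<open>i * \<tau> j\<close>.\<close>
    have bound: "X j i \<le> z + r / 2" if i: "m j \<le> i" "i \<le> n j" for i
    proof -
      have "\<exists>t\<in>{t0..t0 + s}. nat \<lfloor>t / \<tau> j\<rfloor> = i"
      proof (cases "i = m j")
        case True
        then show ?thesis using s by (intro bexI[of _ t0]) (auto simp: m_def)
      next
        case False
        have "t0 / \<tau> j < real i" using False i(1) unfolding m_def by linarith
        moreover have "real i \<le> (t0 + s) / \<tau> j"
          using i(2) t0 s tau_pos[of j] unfolding n_def
          by (meson le_nat_floor le_floor_iff of_nat_floor order_trans of_nat_le_iff
              divide_nonneg_pos add_nonneg_nonneg less_imp_le)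
        ultimately have "real i * \<tau> j \<in> {t0..t0 + s}"
          using tau_pos[of j] by (auto simp: field_simps)
        then show ?thesis using tau_pos[of j] by (intro bexI[of _ "real i * \<tau> j"]) auto
      qed
      then obtain t where t: "t \<in> {t0..t0 + s}" "nat \<lfloor>t / \<tau> j\<rfloor> = i" by blast
      then have "dist (X j i) (x t) < r / 4" using elim(4) by blast
      then show ?thesis using near[OF t(1)] unfolding dist_real_def by linarith
    qed
    have iter: "(A ^^ k) (X j (m j) / e j) \<le> X j (m j + k) / e j" if "m j + k \<le> n j" for k
      using that
    proof (induction k)
      case (Suc k)
      have sl: "h (e j * v) / e j - h (e j * u) / e j \<le> S * (v - u)"
        if uv: "u < v" "v \<le> X j (m j + k) / e j + C" for u v
      proof -
        have "e j * v \<le> e j * (X j (m j + k) / e j + C)"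
          using uv(2) e_pos[of j] by (intro mult_left_mono) auto
        also have "\<dots> = X j (m j + k) + e j * C"
          using e_pos[of j] by (simp add: distrib_left)
        also have "\<dots> \<le> z + r" using bound[of "m j + k"] Suc.prems elim(2) by simp
        finally have "h (e j * v) - h (e j * u) \<le> S * (e j * v - e j * u)"
          using uv(1) e_pos[of j] by (intro slope) auto
        also have "\<dots> = (S * (v - u)) * e j" by (simp add: algebra_simps)
        finally show ?thesis
          using e_pos[of j] by (simp add: diff_divide_distrib[symmetric] pos_divide_le_eq)
      qed
      have gap: "S + \<bar>\<gamma> - e j / \<tau> j\<bar> * C < T" using elim(1) by linarith
      have le: "(A ^^ k) (X j (m j) / e j) \<le> X j (m j + k) / e j" using Suc by simp
      have "A ((A ^^ k) (X j (m j) / e j)) \<le> X j (Suc (m j + k)) / e j"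
        by (rule step_comparison[OF pos _ lip C sl gap A rescaled_minimiser[OF e_pos X] le])
          (use elim(3) in auto)
      then show ?case by simp
    qed simp
    have "X j (m j) / e j - real (n j - m j) * \<rho> - 2 \<le> (A ^^ (n j - m j)) (X j (m j) / e j)"
      using \<rho>[of "X j (m j) / e j" "n j - m j"] by linarith
    also have "\<dots> \<le> X j (n j) / e j" using iter[of "n j - m j"] mn[of j] by simp
    finally have "e j * (X j (m j) / e j - real (n j - m j) * \<rho> - 2) \<le> e j * (X j (n j) / e j)"
      using e_pos[of j] by (intro mult_left_mono) auto
    then show ?case using e_pos[of j] by (simp add: right_diff_distrib distrib_left)
  qed
  have steps: "(\<lambda>j. \<tau> j * real (n j - m j)) \<longlonglongrightarrow> s"
  proof (rule tendsto_sandwich)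
    have fl: "\<tau> j * real (n j - m j) \<in> {s - \<tau> j..s + \<tau> j}" for j
    proof -
      have nn: "0 \<le> t0 / \<tau> j" "0 \<le> (t0 + s) / \<tau> j" using t0 s tau_pos[of j] by auto
      have "real (m j) \<le> t0 / \<tau> j" "t0 / \<tau> j \<le> real (m j) + 1"
        "real (n j) \<le> (t0 + s) / \<tau> j" "(t0 + s) / \<tau> j \<le> real (n j) + 1"
        unfolding m_def n_def using nn by linarith+
      then show ?thesis
        using mn[of j] tau_pos[of j] by (simp add: field_simps)
    qed
    show "\<forall>\<^sub>F j in sequentially. s - \<tau> j \<le> \<tau> j * real (n j - m j)"
      "\<forall>\<^sub>F j in sequentially. \<tau> j * real (n j - m j) \<le> s + \<tau> j"
      using fl by auto
    show "(\<lambda>j. s - \<tau> j) \<longlonglongrightarrow> s" "(\<lambda>j. s + \<tau> j) \<longlonglongrightarrow> s"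
      using tendsto_diff[OF tendsto_const tau_lim, of s] tendsto_add[OF tendsto_const tau_lim, of s]
      by simp_all
  qed
  have eN: "e j * (real (n j - m j) * \<rho> + 2) =
      (e j / \<tau> j) * (\<tau> j * real (n j - m j)) * \<rho> + e j * 2" for j
    using tau_pos[of j] by (simp add: field_simps)
  have lim_left: "(\<lambda>j. - (e j * (real (n j - m j) * \<rho> + 2))) \<longlonglongrightarrow> - (\<gamma> * s * \<rho> + 0 * 2)"
    unfolding eN by (intro tendsto_intros ratio steps e_lim)
  have pt: "(\<lambda>j. X j (nat \<lfloor>t / \<tau> j\<rfloor>)) \<longlonglongrightarrow> x t" if "t \<in> {t0..t0 + s}" for t
    using tendsto_uniform_limitI[OF conv that] .
  have "(\<lambda>j. X j (n j) - X j (m j)) \<longlonglongrightarrow> x (t0 + s) - x t0"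
    unfolding n_def m_def using s by (intro tendsto_diff pt) auto
  from tendsto_le[OF trivial_limit_sequentially this lim_left ev] show ?thesis by simp
qed

text \<open>Only times after \<open>t0\<close> are used, so that \<open>t0 = 0\<close> is included; continuity at \<open>t0\<close>
  provides an interval on which the increment bound applies.\<close>

lemma velocity_lower_bound:
  fixes W h x :: "real \<Rightarrow> real" and X :: "nat \<Rightarrow> nat \<Rightarrow> real" and e \<tau> :: "nat \<Rightarrow> real"
  assumes pos: "0 < \<gamma>" and lip: "L-lipschitz_on UNIV W"
    and e_pos: "\<And>j. 0 < e j" and e_lim: "e \<longlonglongrightarrow> 0"
    and tau_pos: "\<And>j. 0 < \<tau> j" and tau_lim: "\<tau> \<longlonglongrightarrow> 0"
    and ratio: "(\<lambda>j. e j / \<tau> j) \<longlonglongrightarrow> \<gamma>"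
    and X: "\<And>j i. minimiser (\<lambda>x. energy h W (e j) x + 1 / (2 * \<tau> j) * (x - X j i)\<^sup>2) (X j (Suc i))"
    and t0: "0 \<le> t0"
    and conv: "\<And>K. compact K \<Longrightarrow> K \<subseteq> {0..} \<Longrightarrow>
      uniform_limit K (\<lambda>j t. X j (nat \<lfloor>t / \<tau> j\<rfloor>)) x sequentially"
    and deriv: "(x has_real_derivative v) (at t0 within {0..})"
    and A: "\<And>w. minimiser (\<lambda>y. T * y + W y + \<gamma> / 2 * (y - w)\<^sup>2) (A w)"
    and \<rho>: "\<And>y n. \<bar>y - (A ^^ n) y - real n * \<rho>\<bar> \<le> 2"
    and ST: "S < T" and r: "0 < r"
    and slope: "\<And>u w. u < w \<Longrightarrow> w \<le> x t0 + r \<Longrightarrow> h w - h u \<le> S * (w - u)"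
  shows "- v \<le> \<gamma> * \<rho>"
proof -
  have "continuous (at t0 within {0..}) x" using deriv by (rule DERIV_continuous)
  then obtain d where d: "0 < d" "\<And>t. 0 \<le> t \<Longrightarrow> \<bar>t - t0\<bar> < d \<Longrightarrow> \<bar>x t - x t0\<bar> < r / 4"
    using r unfolding continuous_within_eps_delta dist_real_def
    by (metis atLeast_iff zero_less_divide_iff zero_less_numeral)
  have quotient: "- (\<gamma> * \<rho>) \<le> (x t - x t0) / (t - t0)" if t: "t0 < t" "t < t0 + d" for t
  proof -
    have near: "x u \<le> x t0 + r / 4" if "u \<in> {t0..t0 + (t - t0)}" for u
    proof -
      have "\<bar>x u - x t0\<bar> < r / 4" using that t t0 by (intro d(2)) auto
      then show ?thesis by linarith
    qed
    have "- (\<gamma> * (t - t0) * \<rho>) \<le> x (t0 + (t - t0)) - x t0"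
      by (rule increment_lower_bound[OF pos lip e_pos e_lim tau_pos tau_lim ratio X t0 _ conv A \<rho> ST r slope near])
        (use t t0 in auto)
    then show ?thesis using t by (simp add: field_simps)
  qed
  have "((\<lambda>t. (x t - x t0) / (t - t0)) \<longlongrightarrow> v) (at t0 within {0..})"
    using deriv unfolding has_field_derivative_iff .
  then have lim: "((\<lambda>t. (x t - x t0) / (t - t0)) \<longlongrightarrow> v) (at_right t0)"
    by (rule tendsto_mono[rotated]) (use t0 in \<open>auto intro!: at_le\<close>)
  have "\<forall>\<^sub>F t in at_right t0. - (\<gamma> * \<rho>) \<le> (x t - x t0) / (t - t0)"
    unfolding eventually_at_right_field using quotient d(1) by (intro exI[of _ "t0 + d"]) auto
  then have "- (\<gamma> * \<rho>) \<le> v" by (rule tendsto_lowerbound[OF lim]) simp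
  then show ?thesis by simp
qed

text \<open>The previous lemma applied to the reflected data: \<open>- X\<close> is a discrete solution for the
  reflected energy, and the reflected step map has slope \<open>- T\<close> and rotation number
  \<open>- \<rho>\<close>.\<close>

lemma velocity_upper_bound:
  fixes W h x :: "real \<Rightarrow> real" and X :: "nat \<Rightarrow> nat \<Rightarrow> real" and e \<tau> :: "nat \<Rightarrow> real"
  assumes pos: "0 < \<gamma>" and lip: "L-lipschitz_on UNIV W"
    and e_pos: "\<And>j. 0 < e j" and e_lim: "e \<longlonglongrightarrow> 0"
    and tau_pos: "\<And>j. 0 < \<tau> j" and tau_lim: "\<tau> \<longlonglongrightarrow> 0"
    and ratio: "(\<lambda>j. e j / \<tau> j) \<longlonglongrightarrow> \<gamma>"
    and X: "\<And>j i. minimiser (\<lambda>x. energy h W (e j) x + 1 / (2 * \<tau> j) * (x - X j i)\<^sup>2) (X j (Suc i))"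
    and t0: "0 \<le> t0"
    and conv: "\<And>K. compact K \<Longrightarrow> K \<subseteq> {0..} \<Longrightarrow>
      uniform_limit K (\<lambda>j t. X j (nat \<lfloor>t / \<tau> j\<rfloor>)) x sequentially"
    and deriv: "(x has_real_derivative v) (at t0 within {0..})"
    and A: "\<And>w. minimiser (\<lambda>y. T * y + W y + \<gamma> / 2 * (y - w)\<^sup>2) (A w)"
    and \<rho>: "\<And>y n. \<bar>y - (A ^^ n) y - real n * \<rho>\<bar> \<le> 2"
    and TS: "T < S" and r: "0 < r"
    and slope: "\<And>u w. u < w \<Longrightarrow> x t0 - r \<le> u \<Longrightarrow> S * (w - u) \<le> h w - h u"
  shows "\<gamma> * \<rho> \<le> - v"
proof -
  have reflect: "minimiser (\<lambda>y. F (- y)) (- q)" if "minimiser F q" for F :: "real \<Rightarrow> real" and q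
    using that by (simp add: is_arg_min_linorder)
  have sq: "(- y - w)\<^sup>2 = (y - - w)\<^sup>2" for y w :: real
    by (metis power2_minus minus_add_distrib diff_minus_eq_add uminus_add_conv_diff add.commute)
  have iter: "((\<lambda>w. - A (- w)) ^^ n) y = - (A ^^ n) (- y)" for n y
    by (induction n) auto
  have "- (- v) \<le> \<gamma> * (- \<rho>)"
  proof (rule velocity_lower_bound[where X = "\<lambda>j i. - X j i" and x = "\<lambda>t. - x t" and h = "\<lambda>p. h (- p)"
        and W = "\<lambda>p. W (- p)" and A = "\<lambda>w. - A (- w)" and T = "- T" and S = "- S",
        OF pos _ e_pos e_lim tau_pos tau_lim ratio _ t0 _ _ _ _ _ r])
    show "L-lipschitz_on UNIV (\<lambda>p. W (- p))"
    proof (rule lipschitz_onI)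
      show "dist (W (- p)) (W (- q)) \<le> L * dist p q" for p q
        using lipschitz_onD[OF lip, of "- p" "- q"] by (simp add: dist_real_def abs_minus_commute)
    qed (rule lipschitz_on_nonneg[OF lip])
    show "minimiser (\<lambda>p. energy (\<lambda>p. h (- p)) (\<lambda>p. W (- p)) (e j) p
        + 1 / (2 * \<tau> j) * (p - - X j i)\<^sup>2) (- X j (Suc i))" for j i
      using reflect[OF X[of j i]] by (simp add: energy_def sq)
    show "uniform_limit K (\<lambda>j t. - X j (nat \<lfloor>t / \<tau> j\<rfloor>)) (\<lambda>t. - x t) sequentially"
      if "compact K" "K \<subseteq> {0..}" for K
      using conv[OF that] by (rule uniform_limit_uminus)
    show "((\<lambda>t. - x t) has_real_derivative - v) (at t0 within {0..})"
      using deriv by (rule DERIV_minus)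
    show "minimiser (\<lambda>y. - T * y + W (- y) + \<gamma> / 2 * (y - w)\<^sup>2) (- A (- w))" for w
      using reflect[OF A[of "- w"]] sq[of _ "- w"] by simp
    show "\<bar>y - ((\<lambda>w. - A (- w)) ^^ n) y - real n * - \<rho>\<bar> \<le> 2" for y n
      using \<rho>[of "- y" n] unfolding iter by (simp add: abs_le_iff)
    show "- S < - T" using TS by simp
    show "h (- w) - h (- u) \<le> - S * (w - u)" if "u < w" "w \<le> - x t0 + r" for u w
      using slope[of "- w" "- u"] that by (simp add: algebra_simps)
  qed
  then show ?thesis by simp
qed

section \<open>Strictly convex functions of one variable\<close>

text \<open>A supporting line of a convex function lies below the graph; if it touched the graph a second time,
  it would lie above the graph at the midpoint.\<close>

lemma strict_subgradient_exists:
  assumes "strictly_convex h"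
  obtains G where "\<And>p q. p \<noteq> q \<Longrightarrow> h p + G p * (q - p) < h q"
proof -
  have conv: "convex_on UNIV h"
  proof (rule convex_onI)
    show "h ((1 - t) *\<^sub>R p + t *\<^sub>R q) \<le> (1 - t) * h p + t * h q" if "0 < t" "t < 1" for t p q
      using assms that unfolding strictly_convex_def
      by (cases "p = q") (auto simp: algebra_simps intro: less_imp_le)
  qed simp
  have "\<exists>g. \<forall>q. p \<noteq> q \<longrightarrow> h p + g * (q - p) < h q" for p
  proof -
    obtain g where g: "\<And>q. h p + g * (q - p) \<le> h q"
      using convex_le_Inf_differential[OF conv, of p] by auto
    have "h p + g * (q - p) < h q" if "p \<noteq> q" for q
    proof -
      have "h ((1 - 1 / 2) * p + 1 / 2 * q) < (1 - 1 / 2) * h p + 1 / 2 * h q"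
        using assms[unfolded strictly_convex_def, rule_format, of p q "1 / 2"] that by simp
      then show ?thesis using g[of "(1 - 1 / 2) * p + 1 / 2 * q"] by (simp add: field_simps)
    qed
    then show ?thesis by blast
  qed
  then show ?thesis using that by metis
qed

lemma subgradient_strict_mono:
  fixes G h :: "real \<Rightarrow> real"
  assumes G: "\<And>p q. p \<noteq> q \<Longrightarrow> h p + G p * (q - p) < h q"
  shows "strict_mono G"
proof (rule strict_monoI)
  fix p q :: real assume "p < q"
  then have "G p * (q - p) < G q * (q - p)"
    using G[of p q] G[of q p] by (simp add: algebra_simps)
  then show "G p < G q" using \<open>p < q\<close> by simp
qed

lemma subgradient_eq_deriv:
  fixes G h :: "real \<Rightarrow> real"
  assumes G: "\<And>p q. p \<noteq> q \<Longrightarrow> h p + G p * (q - p) < h q"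
    and "h field_differentiable at p"
  shows "deriv h p = G p"
proof -
  have "(h has_real_derivative deriv h p) (at p)"
    using assms(2) by (simp add: DERIV_deriv_iff_field_differentiable)
  then have "((\<lambda>q. h q - G p * (q - p)) has_real_derivative deriv h p - G p) (at p)"
    by (auto intro!: derivative_eq_intros)
  moreover have "h p - G p * (p - p) \<le> h q - G p * (q - p)" for q
    using G[of p q] by (cases "p = q") auto
  ultimately have "deriv h p - G p = 0"
    by (intro DERIV_local_min[of _ _ p 1]) auto
  then show ?thesis by simp
qed

text \<open>The difference quotient at \<open>p\<close> lies between the subgradients at \<open>p\<close> and \<open>q\<close>,
  so \<open>h\<close> is differentiable wherever the monotone function \<open>G\<close> is continuous.\<close>

lemma countable_nondifferentiable:
  fixes G h :: "real \<Rightarrow> real"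
  assumes G: "\<And>p q. p \<noteq> q \<Longrightarrow> h p + G p * (q - p) < h q"
  shows "countable {p. \<not> h field_differentiable at p}"
proof (rule countable_subset)
  have mono: "mono G"
    using subgradient_strict_mono[of h G, OF G] by (rule strict_mono_mono)
  show "countable {p. \<not> isCont G p}" using mono by (rule mono_ctble_discont)
  show "{p. \<not> h field_differentiable at p} \<subseteq> {p. \<not> isCont G p}"
  proof (intro subsetI CollectI notI)
    fix p assume p: "p \<in> {p. \<not> h field_differentiable at p}" and cont: "isCont G p"
    have close: "\<bar>(h q - h p) / (q - p) - G p\<bar> \<le> \<bar>G q - G p\<bar>" if "q \<noteq> p" for q
    proof (cases "p < q")
      case True
      then have "G p \<le> (h q - h p) / (q - p)" "(h q - h p) / (q - p) \<le> G q"
        using G[of p q] G[of q p] by (simp_all add: field_simps)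
      then show ?thesis by linarith
    next
      case False
      then have "(h q - h p) / (q - p) \<le> G p" "G q \<le> (h q - h p) / (q - p)"
        using that G[of p q] G[of q p] by (simp_all add: field_simps)
      then show ?thesis by linarith
    qed
    have "((\<lambda>q. (h q - h p) / (q - p)) \<longlongrightarrow> G p) (at p)"
    proof (rule LIM_zero_cancel, rule Lim_transform_bound)
      show "\<forall>\<^sub>F q in at p. norm ((h q - h p) / (q - p) - G p) \<le> norm (G q - G p)"
        using close by (auto simp: eventually_at_filter)
      show "((\<lambda>q. G q - G p) \<longlongrightarrow> 0) (at p)"
        using cont by (simp add: isCont_def LIM_zero)
    qed
    then show False
      using p unfolding field_differentiable_def has_field_derivative_iff by blast
  qed
qed

text \<open>A limit along a trivial filter would be an arbitrary value; this lemma makes the limits in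
  \<open>right_value\<close> (with \<open>c = 1\<close>) and \<open>left_value\<close> (with \<open>c = - 1\<close>) meaningful.\<close>

lemma one_sided_filter_nontrivial:
  fixes c z :: real
  assumes "countable {p. \<not> P p}" "c \<noteq> 0"
  shows "at 0 within {\<delta>. 0 < \<delta> \<and> P (z + c * \<delta>)} \<noteq> bot"
proof -
  let ?D = "{\<delta>. 0 < \<delta> \<and> P (z + c * \<delta>)}"
  have cnt: "countable {\<delta>. \<not> P (z + c * \<delta>)}"
  proof (rule countable_subset)
    show "countable ((\<lambda>p. (p - z) / c) ` {p. \<not> P p})" using assms(1) by simp
    show "{\<delta>. \<not> P (z + c * \<delta>)} \<subseteq> (\<lambda>p. (p - z) / c) ` {p. \<not> P p}"
      using assms(2) by (auto intro!: image_eqI[of _ _ "z + c * _"])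
  qed
  have "\<exists>\<delta>\<in>?D. \<delta> \<noteq> 0 \<and> dist \<delta> 0 < e" if "0 < e" for e
  proof -
    have "\<not> {0<..<e} \<subseteq> {\<delta>. \<not> P (z + c * \<delta>)}"
      using cnt uncountable_open_interval[of 0 e] that countable_subset by blast
    then show ?thesis by (auto simp: dist_real_def)
  qed
  then have "0 islimpt ?D" by (simp add: islimpt_approachable)
  then show ?thesis by (simp add: trivial_limit_within)
qed

lemma one_sided_limit_exists:
  fixes \<phi> \<psi> :: "real \<Rightarrow> real"
  assumes D: "D \<subseteq> {0<..}" and nontriv: "at 0 within D \<noteq> bot"
    and eq: "\<And>\<delta>. \<delta> \<in> D \<Longrightarrow> \<phi> \<delta> = \<psi> \<delta>"
    and mono: "\<And>p q. 0 < p \<Longrightarrow> p \<le> q \<Longrightarrow> \<psi> p \<le> \<psi> q"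
    and K: "\<And>\<delta>. 0 < \<delta> \<Longrightarrow> K \<le> \<psi> \<delta>"
  obtains l where "K \<le> l" "(\<phi> \<longlongrightarrow> l) (at 0 within D)"
proof -
  define l where "l = Inf (\<phi> ` ({0<..} \<inter> D))"
  have "(\<phi> \<longlongrightarrow> l) (at 0 within ({0<..} \<inter> D))"
    unfolding l_def using mono K by (intro Lim_right_bound) (auto simp: eq)
  moreover have "{0<..} \<inter> D = D" using D by blast
  ultimately have lim: "(\<phi> \<longlongrightarrow> l) (at 0 within D)" by simp
  have "\<forall>\<^sub>F \<delta> in at 0 within D. K \<le> \<phi> \<delta>"
    unfolding eventually_at_filter using D K by (auto simp: eq intro!: always_eventually)
  then have "K \<le> l" by (rule tendsto_lowerbound[OF lim _ nontriv])
  then show ?thesis using that lim by blast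
qed

text \<open>The bound for subgradients passes to the limit because \<open>h'\<close> coincides with \<open>G\<close> where it
  exists, and monotonicity of \<open>f \<circ> G\<close> guarantees that there is a limit.\<close>

lemma right_value_lower_bound:
  fixes G h f :: "real \<Rightarrow> real"
  assumes f: "mono f"
    and G: "\<And>p q. p \<noteq> q \<Longrightarrow> h p + G p * (q - p) < h q"
    and K: "\<And>\<delta>. 0 < \<delta> \<Longrightarrow> K \<le> f (G (z + \<delta>))"
  shows "K \<le> right_value f h z"
proof -
  let ?D = "{\<delta>. 0 < \<delta> \<and> h field_differentiable at (z + \<delta>)}"
  have nontriv: "at 0 within ?D \<noteq> bot"
    using one_sided_filter_nontrivial[OF countable_nondifferentiable[OF G], where c = 1] by simp
  have mono: "mono G"
    using subgradient_strict_mono[of h G, OF G] by (rule strict_mono_mono)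
  obtain l where l: "K \<le> l" "((\<lambda>\<delta>. f (deriv h (z + \<delta>))) \<longlongrightarrow> l) (at 0 within ?D)"
  proof (rule one_sided_limit_exists[where D = ?D and K = K
        and \<phi> = "\<lambda>\<delta>. f (deriv h (z + \<delta>))" and \<psi> = "\<lambda>\<delta>. f (G (z + \<delta>))"])
    show "f (deriv h (z + \<delta>)) = f (G (z + \<delta>))" if "\<delta> \<in> ?D" for \<delta>
      using that subgradient_eq_deriv[of h G, OF G] by simp
    show "f (G (z + p)) \<le> f (G (z + q))" if "p \<le> q" for p q
      using that by (intro monoD[OF f] monoD[OF mono]) simp
  qed (use nontriv K in auto)
  then show ?thesis
    unfolding right_value_def using tendsto_Lim[OF nontriv l(2)] by simp
qed

lemma left_value_upper_bound:
  fixes G h f :: "real \<Rightarrow> real"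
  assumes f: "mono f"
    and G: "\<And>p q. p \<noteq> q \<Longrightarrow> h p + G p * (q - p) < h q"
    and K: "\<And>\<delta>. 0 < \<delta> \<Longrightarrow> f (G (z - \<delta>)) \<le> K"
  shows "left_value f h z \<le> K"
proof -
  let ?D = "{\<delta>. 0 < \<delta> \<and> h field_differentiable at (z - \<delta>)}"
  have nontriv: "at 0 within ?D \<noteq> bot"
    using one_sided_filter_nontrivial[OF countable_nondifferentiable[OF G], where c = "- 1"] by simp
  have mono: "mono G"
    using subgradient_strict_mono[of h G, OF G] by (rule strict_mono_mono)
  obtain l where l: "- K \<le> l" "((\<lambda>\<delta>. - f (deriv h (z - \<delta>))) \<longlongrightarrow> l) (at 0 within ?D)"
  proof (rule one_sided_limit_exists[where D = ?D and K = "- K"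
        and \<phi> = "\<lambda>\<delta>. - f (deriv h (z - \<delta>))" and \<psi> = "\<lambda>\<delta>. - f (G (z - \<delta>))"])
    show "- f (deriv h (z - \<delta>)) = - f (G (z - \<delta>))" if "\<delta> \<in> ?D" for \<delta>
      using that subgradient_eq_deriv[of h G, OF G] by simp
    show "- f (G (z - p)) \<le> - f (G (z - q))" if "p \<le> q" for p q
      using that by (simp add: monoD[OF f] monoD[OF mono])
  qed (use nontriv K in auto)
  then have "((\<lambda>\<delta>. f (deriv h (z - \<delta>))) \<longlongrightarrow> - l) (at 0 within ?D)"
    using tendsto_minus[OF l(2)] by simp
  then show ?thesis
    unfolding left_value_def using tendsto_Lim[OF nontriv] l(1) by fastforce
qed

section \<open>The two-sided velocity estimate\<close>

theorem theorem5p1: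
  fixes \<gamma> :: real
    and h W x \<tau> x0 :: "real \<Rightarrow> real"
    and a :: "real \<Rightarrow> real \<Rightarrow> real"
    and x_init t0 v :: real
  assumes gamma_pos: "0 < \<gamma>"
    and h_nonneg: "\<And>z. 0 \<le> h z"
    and h_convex: "strictly_convex h"
    and h_min: "minimiser h 0"
    and W_periodic: "\<And>z. W (z + 1) = W z"
    and W_even: "\<And>z. W (- z) = W z"
    and W_lipschitz: "\<exists>L. L-lipschitz_on UNIV W"
    and W_deriv_norm: "esssup lebesgue (\<lambda>z. ereal \<bar>deriv W z\<bar>) = 1"
    and W_average: "integral {0..1} W = 0"
    and tau_pos: "\<And>\<epsilon>. 0 < \<epsilon> \<Longrightarrow> 0 < \<tau> \<epsilon>"
    and tau_lim: "(\<tau> \<longlongrightarrow> 0) (at_right 0)"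
    and ratio_lim: "((\<lambda>\<epsilon>. \<epsilon> / \<tau> \<epsilon>) \<longlongrightarrow> \<gamma>) (at_right 0)"
    and init_lim: "(x0 \<longlongrightarrow> x_init) (at_right 0)"
    and movement: "minimising_movement (energy h W) \<tau> x0 x"
    and selection: "minimiser_selection \<gamma> W a"
    and t0_nonneg: "0 \<le> t0"
    and x_deriv: "(x has_real_derivative v) (at t0 within {0..})"
  shows "\<gamma> * left_value (f_gamma a) h (x t0) \<le> - v \<and>
         - v \<le> \<gamma> * right_value (f_gamma a) h (x t0)"
proof -
  define z where "z = x t0"
  obtain L where lip: "L-lipschitz_on UNIV W" using W_lipschitz by blast
  obtain G where G: "\<And>p q. p \<noteq> q \<Longrightarrow> h p + G p * (q - p) < h q"
    using strict_subgradient_exists[OF h_convex] by blast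
  have strict: "strict_mono G" using subgradient_strict_mono[of h G, OF G] .
  obtain X e where X: "\<And>\<epsilon>. 0 < \<epsilon> \<Longrightarrow> discrete_solution (energy h W \<epsilon>) (\<tau> \<epsilon>) (x0 \<epsilon>) (X \<epsilon>)"
    and e: "\<And>j::nat. 0 < e j" "e \<longlonglongrightarrow> 0"
    and conv: "\<And>K. compact K \<Longrightarrow> K \<subseteq> {0..} \<Longrightarrow>
      uniform_limit K (\<lambda>j t. X (e j) (nat \<lfloor>t / \<tau> (e j)\<rfloor>)) x sequentially"
    using movement unfolding minimising_movement_def by blast
  have e_right: "filterlim e (at_right 0) sequentially"
    unfolding filterlim_at using e by (auto simp: less_imp_neq[symmetric] intro!: always_eventually)
  have tau: "(\<lambda>j. \<tau> (e j)) \<longlonglongrightarrow> 0" "(\<lambda>j. e j / \<tau> (e j)) \<longlonglongrightarrow> \<gamma>"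
    using filterlim_compose[OF tau_lim e_right] filterlim_compose[OF ratio_lim e_right] by simp_all
  have step: "minimiser (\<lambda>p. energy h W (e j) p + 1 / (2 * \<tau> (e j)) * (p - X (e j) i)\<^sup>2)
      (X (e j) (Suc i))" for j i
    using X[OF e(1)] unfolding discrete_solution_def by blast
  have sel: "minimiser (\<lambda>y. T * y + W y + \<gamma> / 2 * (y - w)\<^sup>2) (a T w)" for T w
    using selection unfolding minimiser_selection_def by blast
  note disp = f_gamma_displacement[OF gamma_pos selection]
  have slope_le: "h w - h u \<le> G q * (w - u)" if "u < w" "w \<le> q" for u w q
  proof -
    have "h w - h u \<le> G w * (w - u)" using G[of w u] that by (simp add: algebra_simps)
    also have "\<dots> \<le> G q * (w - u)"
      using that monoD[OF strict_mono_mono[OF strict], of w q] by (intro mult_right_mono) auto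
    finally show ?thesis .
  qed
  have slope_ge: "G q * (w - u) \<le> h w - h u" if "u < w" "q \<le> u" for u w q
  proof -
    have "G q * (w - u) \<le> G u * (w - u)"
      using that monoD[OF strict_mono_mono[OF strict], of q u] by (intro mult_right_mono) auto
    also have "\<dots> \<le> h w - h u" using G[of u w] that by (simp add: algebra_simps)
    finally show ?thesis .
  qed
  \<comment> \<open>At \<open>z + \<delta> / 2\<close> the subgradient bounds all slopes further left and is strictly
    below the one at \<open>z + \<delta>\<close>: this is the gap that the comparison needs.\<close>
  have right: "- v / \<gamma> \<le> f_gamma a (G (z + \<delta>))" if "0 < \<delta>" for \<delta>
  proof -
    have "- v \<le> \<gamma> * f_gamma a (G (z + \<delta>))"
      by (rule velocity_lower_bound[where S = "G (z + \<delta> / 2)" and r = "\<delta> / 2",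
            OF gamma_pos lip e tau_pos[OF e(1)] tau step t0_nonneg conv x_deriv sel disp _ _ slope_le])
        (use that strict_monoD[OF strict] in \<open>auto simp: z_def\<close>)
    then show ?thesis using gamma_pos by (simp add: field_simps)
  qed
  have left: "f_gamma a (G (z - \<delta>)) \<le> - v / \<gamma>" if "0 < \<delta>" for \<delta>
  proof -
    have "\<gamma> * f_gamma a (G (z - \<delta>)) \<le> - v"
      by (rule velocity_upper_bound[where S = "G (z - \<delta> / 2)" and r = "\<delta> / 2",
            OF gamma_pos lip e tau_pos[OF e(1)] tau step t0_nonneg conv x_deriv sel disp _ _ slope_ge])
        (use that strict_monoD[OF strict] in \<open>auto simp: z_def\<close>)
    then show ?thesis using gamma_pos by (simp add: field_simps)
  qed
  have mono: "mono (f_gamma a)" by (rule f_gamma_mono[OF gamma_pos selection])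
  have "- v / \<gamma> \<le> right_value (f_gamma a) h z"
    by (rule right_value_lower_bound[OF mono G right])
  moreover have "left_value (f_gamma a) h z \<le> - v / \<gamma>"
    by (rule left_value_upper_bound[OF mono G left])
  ultimately show ?thesis using gamma_pos unfolding z_def by (simp add: field_simps)
qed

end
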